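(* Let $G$ be a connected triangle-free graph of order $n$, size $m$ (number of edges), minimum degree $\delta\geq 2$ and vertex-connectivity $\kappa$. If $$m \geq \delta^2+\left\lfloor\tfrac14 (n-\delta-1)^2\right\rfloor,$$ then $\kappa=\delta$, unless $V(G)=X\cup S\cup Y$ (disjoint union) where $S$ is a minimum vertex-cut of $G$ with $G[S]=\overline{K_{\delta-1}}$ (i.e. $S$ is an independent set of $\delta-1$ vertices), $G[X\cup S]\cong K_{\delta, \delta}$ and $G[Y\cup S] \cong K_{\lceil(n-\delta-1)/2\rceil,\lfloor(n-\delta-1)/2\rfloor}$.
   Context: All graphs are finite, simple and undirected. A vertex-cut of a connected graph is a set of vertices whose removal disconnects it; the vertex-connectivity $\kappa(G)$ of a connected non-complete graph is the minimum size of a vertex-cut, and $\kappa(K_n)=n-1$; a minimum vertex-cut is one of size $\kappa(G)$. $G[Z]$ is the subgraph induced by $Z$, $\overline{K_r}$ is the edgeless graph on $r$ vertices, and $K_{a,b}$ is the complete bipartite graph. *)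

theory Defs
  imports Complex_Main
begin

record 'a ugraph =
  verts :: "'a set"
  edges :: "'a set set"

definition simple_graph :: "'a ugraph \<Rightarrow> bool" where
  "simple_graph G \<longleftrightarrow>
     finite (verts G) \<and> (\<forall>e\<in>edges G. e \<subseteq> verts G \<and> card e = 2)"

definition order :: "'a ugraph \<Rightarrow> nat" where
  "order G = card (verts G)"

definition size_graph :: "'a ugraph \<Rightarrow> nat" where
  "size_graph G = card (edges G)"

definition adj :: "'a ugraph \<Rightarrow> ('a \<times> 'a) set" where
  "adj G = {(u, v). {u, v} \<in> edges G}"

definition degree :: "'a ugraph \<Rightarrow> 'a \<Rightarrow> nat" where
  "degree G v = card {u. (v, u) \<in> adj G}"

(* Only meaningful for a graph with at least one vertex. *)
definition min_degree :: "'a ugraph \<Rightarrow> nat" where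
  "min_degree G = Min (degree G ` verts G)"

definition triangle_free :: "'a ugraph \<Rightarrow> bool" where
  "triangle_free G \<longleftrightarrow>
     \<not> (\<exists>u v w. (u, v) \<in> adj G \<and> (v, w) \<in> adj G \<and> (w, u) \<in> adj G)"

(* The graph without vertices is not connected. *)
definition connected_graph :: "'a ugraph \<Rightarrow> bool" where
  "connected_graph G \<longleftrightarrow>
     verts G \<noteq> {} \<and> (\<forall>u\<in>verts G. \<forall>v\<in>verts G. (u, v) \<in> (adj G)\<^sup>*)"

definition induced :: "'a ugraph \<Rightarrow> 'a set \<Rightarrow> 'a ugraph" where
  "induced G Z = \<lparr>verts = verts G \<inter> Z, edges = {e \<in> edges G. e \<subseteq> Z}\<rparr>"

definition complete_graph :: "'a ugraph \<Rightarrow> bool" where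
  "complete_graph G \<longleftrightarrow>
     (\<forall>u\<in>verts G. \<forall>v\<in>verts G. u \<noteq> v \<longrightarrow> (u, v) \<in> adj G)"

(* S \<noteq> verts G: deleting all vertices does not count as disconnecting G. *)
definition vertex_cut :: "'a ugraph \<Rightarrow> 'a set \<Rightarrow> bool" where
  "vertex_cut G S \<longleftrightarrow>
     S \<subseteq> verts G \<and> S \<noteq> verts G \<and> \<not> connected_graph (induced G (verts G - S))"

(* Intended for connected G; a connected graph has a vertex-cut iff it is not complete. *)
definition vertex_connectivity :: "'a ugraph \<Rightarrow> nat" where
  "vertex_connectivity G =
     (if complete_graph G then order G - 1
      else Min (card ` {S. vertex_cut G S}))"

definition minimum_vertex_cut :: "'a ugraph \<Rightarrow> 'a set \<Rightarrow> bool" where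
  "minimum_vertex_cut G S \<longleftrightarrow> vertex_cut G S \<and> card S = vertex_connectivity G"

definition graph_iso :: "'a ugraph \<Rightarrow> 'b ugraph \<Rightarrow> bool" where
  "graph_iso G H \<longleftrightarrow>
     (\<exists>f. bij_betw f (verts G) (verts H) \<and>
          (\<forall>u\<in>verts G. \<forall>v\<in>verts G. (u, v) \<in> adj G \<longleftrightarrow> (f u, f v) \<in> adj H))"

definition edgeless_graph :: "nat \<Rightarrow> nat ugraph" where
  "edgeless_graph r = \<lparr>verts = {..<r}, edges = {}\<rparr>"

definition complete_bipartite :: "nat \<Rightarrow> nat \<Rightarrow> (nat + nat) ugraph" where
  "complete_bipartite a b =
     \<lparr>verts = Inl ` {..<a} \<union> Inr ` {..<b},
      edges = {{Inl i, Inr j} | i j. i < a \<and> j < b}\<rparr>"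

end

(* The neighbourhood of a vertex of minimum degree is a vertex-cut, so kappa \<le> delta.
   If kappa < delta, a minimum vertex-cut S splits G into X and Y without edges between them.
   Every vertex has at least delta > |S| neighbours, so X contains an edge, whose two ends have
   disjoint neighbourhoods inside X \<union> S; hence |X \<union> S| \<ge> 2 delta, and likewise |Y \<union> S| \<ge> 2 delta.
   Mantel's theorem bounds the edges of both parts, and by convexity the sum of these bounds is
   largest when one part has exactly 2 delta vertices and |S| = delta - 1. The hypothesis on m
   then forces equality everywhere: edges inside S would be counted twice, and the equality case
   of Mantel's theorem makes both parts balanced complete bipartite graphs. *)
theory Submission
  imports Defs
begin

section \<open>Arithmetic of rounded quarter squares\<close>

text \<open>Squares are 0 or 1 modulo 4, so rounding down a quarter of a square loses at most
  1/4.\<close>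

lemma four_mult_square_div_4_ge: "x ^ 2 \<le> 4 * (x ^ 2 div 4) + (1::nat)"
proof -
  have "x ^ 2 mod 4 \<le> 1"
  proof (cases "even x")
    case True
    then obtain k where "x = 2 * k" by blast
    then show ?thesis by (simp add: power2_eq_square)
  next
    case False
    then obtain k where "x = 2 * k + 1" by (rule oddE)
    then have "x ^ 2 = 4 * (k * k + k) + 1" by (simp add: power2_eq_square algebra_simps)
    then show ?thesis by simp
  qed
  then show ?thesis
    using mult_div_mod_eq[of 4 "x ^ 2"] by linarith
qed

lemma mult_le_square_div_4:
  fixes a b :: nat
  shows "a * b \<le> (a + b) ^ 2 div 4"
proof -
  have "0 \<le> (int a - int b) ^ 2" by simp
  then have "int (4 * (a * b)) \<le> int ((a + b) ^ 2)"
    by (simp add: power2_eq_square algebra_simps)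
  then show ?thesis by linarith
qed

text \<open>Since \<open>(a + b) ^ 2 = 4 * (a * b) + (a - b) ^ 2\<close>, reaching the rounded bound
  forces \<open>a - b\<close> to be 0 or 1.\<close>

lemma mult_eq_square_div_4_balanced:
  fixes a b :: nat
  assumes "b \<le> a" and "a * b = (a + b) ^ 2 div 4"
  shows "a = (a + b + 1) div 2" and "b = (a + b) div 2"
proof -
  define k where "k = a - b"
  have a: "a = b + k" using assms(1) by (simp add: k_def)
  have "(a + b) ^ 2 = 4 * (a * b) + k ^ 2"
    by (simp add: a power2_eq_square algebra_simps)
  with assms(2) have "k ^ 2 \<le> 1"
    using four_mult_square_div_4_ge[of "a + b"] by linarith
  then have "k \<le> 1"
    by (metis one_power2 power2_nat_le_eq_le)
  then show "a = (a + b + 1) div 2" "b = (a + b) div 2"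
    using a by auto
qed

text \<open>Without the rounding, the left-hand side of the last hypothesis exceeds the right-hand side
  by \<open>(a - 2 d) (b - 2 d) / 2\<close> when \<open>a + b = N + 2 d\<close>.\<close>

lemma sum_square_div_4_extremal:
  fixes a b d N :: nat
  assumes "1 \<le> d" and "2 * d \<le> a" and "2 * d \<le> b" and "a + b \<le> N + 2 * d"
    and "d ^ 2 + N ^ 2 div 4 \<le> a ^ 2 div 4 + b ^ 2 div 4"
  shows "a + b = N + 2 * d" and "a = 2 * d \<or> b = 2 * d"
proof -
  \<comment> \<open>\<open>s\<close> and \<open>t\<close> are the excesses of \<open>a\<close> and
    \<open>b\<close> over their least value, \<open>r\<close> the shortfall of \<open>a + b\<close>
    from its largest.\<close>
  define s t r where "s = a - 2 * d" and "t = b - 2 * d" and "r = N + 2 * d - (a + b)"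
  have a: "a = 2 * d + s" and b: "b = 2 * d + t" and N: "N = 2 * d + s + t + r"
    using assms by (auto simp: s_def t_def r_def)
  \<comment> \<open>Only the rounding of \<open>N ^ 2\<close> works against the estimate; it costs
    at most 1.\<close>
  have "4 * d ^ 2 + N ^ 2 \<le> a ^ 2 + b ^ 2 + 1"
    using assms(5) four_mult_square_div_4_ge[of N] by linarith
  moreover have "4 * d ^ 2 + N ^ 2 = a ^ 2 + b ^ 2 + 2 * (s * t) + r * (4 * d + 2 * s + 2 * t + r)"
    by (simp add: a b N power2_eq_square algebra_simps)
  ultimately have *: "2 * (s * t) + r * (4 * d + 2 * s + 2 * t + r) \<le> 1"
    by linarith
  have "r = 0"
  proof (rule ccontr)
    assume "r \<noteq> 0"
    then have "4 * d + 2 * s + 2 * t + r \<le> r * (4 * d + 2 * s + 2 * t + r)" by simp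
    also have "\<dots> \<le> 1" using * by (rule add_leD2)
    finally show False using assms(1) by linarith
  qed
  then show "a + b = N + 2 * d" using a b N by simp
  \<comment> \<open>The factor 2 absorbs the rounding error: an even number that is at most 1 is
    0.\<close>
  from * have "s * t = 0" by linarith
  then show "a = 2 * d \<or> b = 2 * d" using a b by auto
qed

section \<open>Mantel's theorem and its equality case\<close>

definition bip_edges :: "'a set \<Rightarrow> 'a set \<Rightarrow> 'a set set" where
  "bip_edges A B = (\<lambda>(a, b). {a, b}) ` (A \<times> B)"

lemma bip_edges_commute: "bip_edges A B = bip_edges B A"
  by (force simp: bip_edges_def insert_commute)

lemma card_bip_edges_le:
  assumes "finite A" and "finite B"
  shows "card (bip_edges A B) \<le> card A * card B"
  unfolding bip_edges_def
  by (metis assms card_cartesian_product card_image_le finite_cartesian_product)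

text \<open>Let \<open>A\<close> be the neighbourhood of a vertex of maximum degree
  \<open>D\<close>. It is independent because there are no triangles, so every edge has an end in
  the complement \<open>B\<close>, and the degrees in \<open>B\<close> sum to at most
  \<open>card B * D\<close>. Equality leaves no room for an edge inside \<open>B\<close>, which that
  sum would count twice.\<close>

lemma mantel_aux:
  fixes V :: "'a set" and E :: "'a set set"
  assumes fin: "finite V" and E: "\<forall>e\<in>E. e \<subseteq> V \<and> card e = 2"
    and tf: "\<not> (\<exists>u v w. {u, v} \<in> E \<and> {v, w} \<in> E \<and> {w, u} \<in> E)"
    and ne: "V \<noteq> {}"
  shows "\<exists>A B. V = A \<union> B \<and> A \<inter> B = {} \<and> card E \<le> card A * card B \<and>
           (card E = card A * card B \<longrightarrow> E = bip_edges A B)"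
proof -
  define nb where "nb v = {u. {v, u} \<in> E}" for v
  have nbV: "nb v \<subseteq> V" for v using E by (auto simp: nb_def)
  then have fnb: "finite (nb v)" for v using fin finite_subset by blast
  define D where "D = Max ((\<lambda>v. card (nb v)) ` V)"
  have "D \<in> (\<lambda>v. card (nb v)) ` V"
    unfolding D_def using fin ne by (intro Max_in) auto
  then obtain v where v: "v \<in> V" "card (nb v) = D" by auto
  have D: "card (nb u) \<le> D" if "u \<in> V" for u
    unfolding D_def using fin that by (intro Max_ge) auto
  define A where "A = nb v"
  define B where "B = V - A"
  have AB: "V = A \<union> B" "A \<inter> B = {}" using nbV by (auto simp: A_def B_def)
  have fA: "finite A" and fB: "finite B" using fnb fin by (auto simp: A_def B_def)
  have cA: "card A = D" by (simp add: A_def v)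
  \<comment> \<open>\<open>F b\<close> is the set of edges at \<open>b\<close>. The sets for
    \<open>b\<close> in \<open>B\<close> will cover \<open>E\<close>.\<close>
  define F where "F b = (\<lambda>u. {b, u}) ` nb b" for b
  have cF: "card (F b) \<le> D" if "b \<in> B" for b
  proof -
    have "card (F b) \<le> card (nb b)" unfolding F_def by (rule card_image_le[OF fnb])
    also have "\<dots> \<le> D" using D that by (simp add: B_def)
    finally show ?thesis .
  qed
  have inF: "{b, u} \<in> F b" "{u, b} \<in> F b" if "{b, u} \<in> E" for b u
    using that unfolding F_def nb_def by (simp_all add: image_iff insert_commute[of u b]) blast+
  have fF: "finite (F b)" for b by (simp add: F_def fnb)
  have indep: "{x, y} \<notin> E" if "x \<in> A" "y \<in> A" for x y
  proof -
    have "{v, x} \<in> E" "{y, v} \<in> E"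
      using that by (simp_all add: A_def nb_def insert_commute[of y v])
    then show ?thesis using tf by blast
  qed
  have two: "\<exists>x y. e = {x, y} \<and> x \<noteq> y \<and> x \<in> V \<and> y \<in> V" if "e \<in> E" for e
  proof -
    from E that have "e \<subseteq> V" "card e = 2" by auto
    then show ?thesis by (auto simp: card_2_iff)
  qed
  have EF: "E \<subseteq> (\<Union>b\<in>B. F b)"
  proof
    fix e assume e: "e \<in> E"
    then obtain x y where xy: "e = {x, y}" "x \<in> V" "y \<in> V" using two by blast
    then have "x \<in> B \<or> y \<in> B" using indep e AB by blast
    then show "e \<in> (\<Union>b\<in>B. F b)"
      using e xy inF[of x y] inF[of y x] by (auto simp: insert_commute[of y x])
  qed
  have sumD: "(\<Sum>b\<in>C. card (F b)) \<le> card C * D" if "C \<subseteq> B" for C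
    using sum_bounded_above[of C "\<lambda>b. card (F b)" D] cF that by auto
  have "card E \<le> card (\<Union>b\<in>B. F b)"
    using EF fB fF by (intro card_mono) auto
  also have "\<dots> \<le> (\<Sum>b\<in>B. card (F b))" by (rule card_UN_le[OF fB])
  also have "\<dots> \<le> card B * D" by (rule sumD) simp
  finally have le: "card E \<le> card A * card B" by (simp add: cA mult.commute)
  have "E = bip_edges A B" if eq: "card E = card A * card B"
  proof -
    have indepB: "{x, y} \<notin> E" if "x \<in> B" "y \<in> B" for x y
    proof
      assume xy: "{x, y} \<in> E"
      \<comment> \<open>The edge lies in both \<open>F x\<close> and \<open>F y\<close>, so the union bound is strict.\<close>
      have "x \<noteq> y" using E xy by fastforce
      have inx: "{x, y} \<in> F x" and iny: "{x, y} \<in> F y"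
        using xy inF[of x y] inF[of y x] by (simp_all add: insert_commute[of y x])
      have "E \<subseteq> (\<Union>b\<in>B - {x}. F b) \<union> (F x - {{x, y}})"
      proof
        fix e assume "e \<in> E"
        then obtain b where b: "b \<in> B" "e \<in> F b" using EF by blast
        show "e \<in> (\<Union>b\<in>B - {x}. F b) \<union> (F x - {{x, y}})"
        proof (cases "e = {x, y}")
          case True
          then show ?thesis using iny \<open>x \<noteq> y\<close> that(2) by auto
        next
          case False
          then show ?thesis using b by (cases "b = x") auto
        qed
      qed
      then have "card E \<le> card ((\<Union>b\<in>B - {x}. F b) \<union> (F x - {{x, y}}))"
        using fB fF by (intro card_mono) auto
      also have "\<dots> \<le> card (\<Union>b\<in>B - {x}. F b) + card (F x - {{x, y}})"
        by (rule card_Un_le)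
      also have "\<dots> \<le> (\<Sum>b\<in>B - {x}. card (F b)) + card (F x - {{x, y}})"
        using card_UN_le[of "B - {x}" F] fB by simp
      also have "\<dots> < (\<Sum>b\<in>B - {x}. card (F b)) + card (F x)"
        using card_Diff1_less[OF fF inx] by simp
      also have "\<dots> = (\<Sum>b\<in>B. card (F b))"
        using sum.remove[OF fB \<open>x \<in> B\<close>, of "\<lambda>b. card (F b)"] by simp
      also have "\<dots> \<le> card B * D" by (rule sumD) simp
      finally show False using eq cA by (simp add: mult.commute)
    qed
    have sub: "E \<subseteq> bip_edges A B"
    proof
      fix e assume e: "e \<in> E"
      then obtain x y where xy: "e = {x, y}" "x \<in> V" "y \<in> V" using two by blast
      then have "x \<in> A \<and> y \<in> B \<or> y \<in> A \<and> x \<in> B"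
        using indep indepB e AB by blast
      then show "e \<in> bip_edges A B"
        unfolding xy(1) bip_edges_def using insert_commute[of x y "{}"] by force
    qed
    have "finite (bip_edges A B)" using fA fB by (simp add: bip_edges_def)
    then show ?thesis
      using sub card_bip_edges_le[OF fA fB] eq by (metis card_seteq)
  qed
  then show ?thesis using AB le by blast
qed

text \<open>The product of the class sizes lies between \<open>card E\<close> and the rounded
  quarter square. If these two agree, the edge set is complete bipartite and the classes are
  balanced.\<close>

lemma mantel:
  fixes V :: "'a set" and E :: "'a set set"
  assumes "finite V" and "\<forall>e\<in>E. e \<subseteq> V \<and> card e = 2"
    and "\<not> (\<exists>u v w. {u, v} \<in> E \<and> {v, w} \<in> E \<and> {w, u} \<in> E)"
    and "V \<noteq> {}"
  shows mantel_le: "card E \<le> (card V) ^ 2 div 4"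
    and mantel_eq: "card E = (card V) ^ 2 div 4 \<Longrightarrow>
      \<exists>A B. V = A \<union> B \<and> A \<inter> B = {} \<and> E = bip_edges A B \<and>
        card A = (card V + 1) div 2 \<and> card B = card V div 2"
proof -
  obtain A B where AB: "V = A \<union> B" "A \<inter> B = {}" and le: "card E \<le> card A * card B"
    and eq: "card E = card A * card B \<longrightarrow> E = bip_edges A B"
    using mantel_aux[OF assms] by blast
  have cV: "card V = card A + card B"
    using AB assms(1) by (simp add: card_Un_disjoint)
  have prod: "card A * card B \<le> (card V) ^ 2 div 4"
    unfolding cV by (rule mult_le_square_div_4)
  with le show "card E \<le> (card V) ^ 2 div 4" by linarith
  assume "card E = (card V) ^ 2 div 4"
  with le prod have prod_eq: "card A * card B = (card V) ^ 2 div 4"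
    and E: "E = bip_edges A B" using eq by auto
  show "\<exists>A B. V = A \<union> B \<and> A \<inter> B = {} \<and> E = bip_edges A B \<and>
        card A = (card V + 1) div 2 \<and> card B = card V div 2"
  proof (cases "card B \<le> card A")
    case True
    then have "card A = (card V + 1) div 2" "card B = card V div 2"
      using mult_eq_square_div_4_balanced[of "card B" "card A"] prod_eq cV by auto
    then show ?thesis using AB E by blast
  next
    \<comment> \<open>The classes trade names, so that the rounded-up half comes first.\<close>
    case False
    then have "card B = (card V + 1) div 2" "card A = card V div 2"
      using mult_eq_square_div_4_balanced[of "card A" "card B"] prod_eq cV
      by (auto simp: ac_simps)
    moreover have "V = B \<union> A" "B \<inter> A = {}" "E = bip_edges B A"
      using AB E by (auto simp: bip_edges_commute)
    ultimately show ?thesis by blast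
  qed
qed

section \<open>Isomorphisms and Mantel's theorem for induced subgraphs\<close>

lemma graph_iso_complete_bipartite:
  fixes H :: "'a ugraph"
  assumes "finite A" and "finite B" and "A \<inter> B = {}"
    and "verts H = A \<union> B" and "edges H = bip_edges A B"
  shows "graph_iso H (complete_bipartite (card A) (card B))"
proof -
  obtain f where f: "bij_betw f A {..<card A}"
    using ex_bij_betw_finite_nat[OF assms(1)] by (auto simp: atLeast0LessThan)
  obtain g where g: "bij_betw g B {..<card B}"
    using ex_bij_betw_finite_nat[OF assms(2)] by (auto simp: atLeast0LessThan)
  define h where "h x = (if x \<in> A then Inl (f x) else Inr (g x) :: nat + nat)" for x
  have hA: "h x = Inl (f x)" if "x \<in> A" for x using that by (simp add: h_def)
  have hB: "h x = Inr (g x)" if "x \<in> B" for x using that assms(3) by (auto simp: h_def)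
  have fA: "f x < card A" if "x \<in> A" for x using f that by (auto simp: bij_betw_def)
  have gB: "g x < card B" if "x \<in> B" for x using g that by (auto simp: bij_betw_def)
  have "bij_betw h A (Inl ` {..<card A})"
    using f hA by (auto simp: bij_betw_def inj_on_def image_iff)
  moreover have "bij_betw h B (Inr ` {..<card B})"
    using g hB by (auto simp: bij_betw_def inj_on_def image_iff)
  ultimately have bij: "bij_betw h (verts H) (verts (complete_bipartite (card A) (card B)))"
    unfolding assms(4) by (auto simp: complete_bipartite_def intro!: bij_betw_combine)
  have "(u, v) \<in> adj H \<longleftrightarrow> (h u, h v) \<in> adj (complete_bipartite (card A) (card B))"
    if uv: "u \<in> A \<union> B" "v \<in> A \<union> B" for u v
  proof -
    have "(u, v) \<in> adj H \<longleftrightarrow> u \<in> A \<and> v \<in> B \<or> v \<in> A \<and> u \<in> B"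
      by (auto simp: adj_def assms(5) bip_edges_def doubleton_eq_iff)
    also have "\<dots> \<longleftrightarrow> (h u, h v) \<in> adj (complete_bipartite (card A) (card B))"
      using uv assms(3)
      by (auto simp: adj_def complete_bipartite_def doubleton_eq_iff hA hB fA gB)
    finally show ?thesis .
  qed
  then show ?thesis unfolding graph_iso_def using bij assms(4) by auto
qed

lemma graph_iso_edgeless_graph:
  assumes "finite (verts H)" and "edges H = {}" and "card (verts H) = r"
  shows "graph_iso H (edgeless_graph r)"
proof -
  obtain f where "bij_betw f (verts H) {..<r}"
    using ex_bij_betw_finite_nat[OF assms(1)] assms(3) by (auto simp: atLeast0LessThan)
  then show ?thesis
    using assms(2) by (auto simp: graph_iso_def edgeless_graph_def adj_def)
qed

text \<open>Triangle-freeness passes to the edges inside \<open>Z\<close>, so Mantel's theorem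
  applies there. \<open>Z\<close> will be one side of a cut together with the cut.\<close>

lemma mantel_induced:
  assumes G: "simple_graph G" "triangle_free G" and Z: "Z \<subseteq> verts G" "Z \<noteq> {}"
  shows card_edges_induced_le: "card {e \<in> edges G. e \<subseteq> Z} \<le> (card Z) ^ 2 div 4"
    and iso_induced_extremal: "card {e \<in> edges G. e \<subseteq> Z} = (card Z) ^ 2 div 4 \<Longrightarrow>
      graph_iso (induced G Z) (complete_bipartite ((card Z + 1) div 2) (card Z div 2))"
proof -
  let ?E = "{e \<in> edges G. e \<subseteq> Z}"
  have fin: "finite Z" using G Z by (auto simp: simple_graph_def intro: finite_subset)
  have E: "\<forall>e\<in>?E. e \<subseteq> Z \<and> card e = 2" using G by (auto simp: simple_graph_def)
  have tf: "\<not> (\<exists>u v w. {u, v} \<in> ?E \<and> {v, w} \<in> ?E \<and> {w, u} \<in> ?E)"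
  proof (intro notI, elim exE conjE)
    fix u v w
    assume "{u, v} \<in> ?E" "{v, w} \<in> ?E" "{w, u} \<in> ?E"
    then have "(u, v) \<in> adj G" "(v, w) \<in> adj G" "(w, u) \<in> adj G"
      by (simp_all add: adj_def)
    with G(2) show False unfolding triangle_free_def by blast
  qed
  show "card ?E \<le> (card Z) ^ 2 div 4" by (rule mantel_le[OF fin E tf Z(2)])
  assume "card ?E = (card Z) ^ 2 div 4"
  then obtain A B where AB: "Z = A \<union> B" "A \<inter> B = {}" "?E = bip_edges A B"
    "card A = (card Z + 1) div 2" "card B = card Z div 2"
    using mantel_eq[OF fin E tf Z(2)] by blast
  have "graph_iso (induced G Z) (complete_bipartite (card A) (card B))"
    using AB Z fin by (intro graph_iso_complete_bipartite) (auto simp: induced_def)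
  then show "graph_iso (induced G Z) (complete_bipartite ((card Z + 1) div 2) (card Z div 2))"
    using AB by simp
qed

section \<open>Degrees, neighbourhoods and vertex-cuts\<close>

lemma adj_sym: "(u, v) \<in> adj G \<Longrightarrow> (v, u) \<in> adj G"
  by (simp add: adj_def insert_commute)

lemma adj_verts:
  assumes "simple_graph G" and "(u, v) \<in> adj G"
  shows "u \<in> verts G" and "v \<in> verts G" and "u \<noteq> v"
  using assms by (fastforce simp: simple_graph_def adj_def)+

lemma finite_neighbours: "simple_graph G \<Longrightarrow> finite {u. (v, u) \<in> adj G}"
  by (rule finite_subset[of _ "verts G"]) (auto simp: adj_verts(2), simp add: simple_graph_def)

lemma min_degree_le_degree:
  assumes "simple_graph G" and "v \<in> verts G"
  shows "min_degree G \<le> degree G v"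
  using assms by (auto simp: min_degree_def simple_graph_def)

text \<open>\<open>C\<close> stands for one side of a cut \<open>S\<close>. The neighbours of
  \<open>x\<close> do not all fit into \<open>S\<close>, so some neighbour \<open>y\<close> lies in
  \<open>C\<close>; the neighbourhoods of \<open>x\<close> and \<open>y\<close> are disjoint and
  stay within \<open>C \<union> S\<close>.\<close>

lemma two_min_degree_le_card:
  assumes G: "simple_graph G" "triangle_free G"
    and Z: "finite Z" "C \<subseteq> verts G" "x \<in> C"
    and S: "finite S" "card S < min_degree G"
    and closed: "\<And>u v. u \<in> C \<Longrightarrow> (u, v) \<in> adj G \<Longrightarrow> v \<in> C \<union> S"
    and CS: "C \<union> S \<subseteq> Z"
  shows "2 * min_degree G \<le> card Z"
proof -
  let ?nb = "\<lambda>v. {u. (v, u) \<in> adj G}"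
  have deg: "min_degree G \<le> card (?nb v)" if "v \<in> C" for v
    using min_degree_le_degree[OF G(1)] that Z(2) by (auto simp: degree_def)
  have "\<not> ?nb x \<subseteq> S"
    using deg[OF Z(3)] S card_mono by (metis leD le_trans)
  then obtain y where y: "(x, y) \<in> adj G" "y \<in> C" using closed Z(3) by blast
  have "?nb x \<inter> ?nb y = {}"
    using G(2) y(1) adj_sym[of x _ G] unfolding triangle_free_def by blast
  then have "card (?nb x \<union> ?nb y) = card (?nb x) + card (?nb y)"
    using finite_neighbours[OF G(1)] by (simp add: card_Un_disjoint)
  moreover have "card (?nb x \<union> ?nb y) \<le> card Z"
    using Z closed[OF Z(3)] closed[OF y(2)] CS by (intro card_mono) blast+
  ultimately show ?thesis using deg[OF Z(3)] deg[OF y(2)] by linarith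
qed

lemma vertex_cut_partition:
  assumes G: "simple_graph G" and S: "vertex_cut G S"
  obtains X Y where "verts G = X \<union> S \<union> Y" "X \<inter> S = {}" "X \<inter> Y = {}" "S \<inter> Y = {}"
    "X \<noteq> {}" "Y \<noteq> {}" "\<And>u v. u \<in> X \<Longrightarrow> v \<in> Y \<Longrightarrow> (u, v) \<notin> adj G"
proof -
  let ?H = "induced G (verts G - S)"
  have vH: "verts ?H = verts G - S" by (auto simp: induced_def)
  \<comment> \<open>As a cut is not the whole vertex set, disconnectedness must come from a pair of
    mutually unreachable vertices.\<close>
  from S have "S \<subseteq> verts G" "verts G - S \<noteq> {}" "\<not> connected_graph ?H"
    by (auto simp: vertex_cut_def)
  then obtain u v where uv: "u \<in> verts G - S" "v \<in> verts G - S" "(u, v) \<notin> (adj ?H)\<^sup>*"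
    by (auto simp: connected_graph_def vH)
  \<comment> \<open>\<open>X\<close> is the component of \<open>u\<close> after deleting
    \<open>S\<close>; \<open>Y\<close> collects all the others.\<close>
  define X where "X = {w \<in> verts G - S. (u, w) \<in> (adj ?H)\<^sup>*}"
  define Y where "Y = verts G - S - X"
  have "(x, y) \<notin> adj G" if "x \<in> X" "y \<in> Y" for x y
  proof
    assume "(x, y) \<in> adj G"
    then have "(x, y) \<in> adj ?H"
      using that by (auto simp: X_def Y_def adj_def induced_def)
    then show False
      using that by (auto simp: X_def Y_def intro: rtrancl_into_rtrancl)
  qed
  moreover have "u \<in> X" "v \<in> Y" using uv by (auto simp: X_def Y_def)
  moreover have "verts G = X \<union> S \<union> Y" "X \<inter> S = {}" "X \<inter> Y = {}" "S \<inter> Y = {}"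
    using \<open>S \<subseteq> verts G\<close> by (auto simp: X_def Y_def)
  ultimately show ?thesis using that[of X Y] by blast
qed

text \<open>Deleting the neighbourhood of a vertex \<open>v\<close> of minimum degree isolates
  \<open>v\<close>. Something else remains: a neighbour \<open>u\<close> of \<open>v\<close> has a
  further neighbour \<open>w\<close>, which is not adjacent to \<open>v\<close> since that would
  close a triangle.\<close>

lemma triangle_free_min_cut:
  assumes G: "simple_graph G" "connected_graph G" "triangle_free G" "2 \<le> min_degree G"
  shows vertex_connectivity_le_min_degree: "vertex_connectivity G \<le> min_degree G"
    and ex_minimum_vertex_cut: "\<exists>S. minimum_vertex_cut G S"
proof -
  let ?nb = "\<lambda>v. {u. (v, u) \<in> adj G}"
  have fin: "finite (verts G)" and ne: "verts G \<noteq> {}"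
    using G by (auto simp: simple_graph_def connected_graph_def)
  have "min_degree G \<in> degree G ` verts G"
    unfolding min_degree_def using fin ne by (intro Min_in) auto
  then obtain v where v: "v \<in> verts G" "degree G v = min_degree G" by auto
  have "?nb v \<noteq> {}" using v G(4) unfolding degree_def by (metis card.empty not_numeral_le_zero)
  then obtain u where u: "(v, u) \<in> adj G" by auto
  have "\<not> ?nb u \<subseteq> {v}"
  proof
    assume "?nb u \<subseteq> {v}"
    then have "card (?nb u) \<le> 1" using card_mono[of "{v}" "?nb u"] by simp
    then show False
      using min_degree_le_degree[OF G(1) adj_verts(2)[OF G(1) u]] G(4) by (simp add: degree_def)
  qed
  then obtain w where w: "(u, w) \<in> adj G" "w \<noteq> v" by auto
  then have vw: "(v, w) \<notin> adj G"
    using G(3) u adj_sym[of v w G] unfolding triangle_free_def by blast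
  have wV: "w \<in> verts G" using adj_verts[OF G(1) w(1)] by simp
  \<comment> \<open>This selects the \<open>Min\<close> branch of
    \<open>vertex_connectivity\<close>.\<close>
  have nc: "\<not> complete_graph G" using vw w(2) wV v(1) unfolding complete_graph_def by metis
  have vv: "(v, v) \<notin> adj G" using adj_verts(3)[OF G(1)] by blast
  let ?H = "induced G (verts G - ?nb v)"
  have "(v, w) \<notin> (adj ?H)\<^sup>*"
  proof
    assume "(v, w) \<in> (adj ?H)\<^sup>*"
    \<comment> \<open>As \<open>w\<close> differs from \<open>v\<close>, the path has a first edge,
      but no neighbour of \<open>v\<close> survives.\<close>
    then obtain z where "(v, z) \<in> adj ?H" using w(2) by (auto elim: converse_rtranclE)
    then show False by (auto simp: adj_def induced_def)
  qed
  moreover have "v \<in> verts ?H" "w \<in> verts ?H"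
    using v wV vw vv by (auto simp: induced_def)
  ultimately have "\<not> connected_graph ?H" by (auto simp: connected_graph_def)
  moreover have "?nb v \<subseteq> verts G" using adj_verts[OF G(1)] by auto
  ultimately have cut: "vertex_cut G (?nb v)"
    using v vv unfolding vertex_cut_def by blast
  let ?C = "{S. vertex_cut G S}"
  have finC: "finite ?C"
    by (rule finite_subset[of _ "Pow (verts G)"]) (auto simp: vertex_cut_def fin)
  have k: "vertex_connectivity G = Min (card ` ?C)"
    using nc by (simp add: vertex_connectivity_def)
  show "vertex_connectivity G \<le> min_degree G"
    unfolding k v(2)[symmetric] degree_def using finC cut by (intro Min_le) auto
  have "vertex_connectivity G \<in> card ` ?C"
    unfolding k using finC cut by (intro Min_in) auto
  then show "\<exists>S. minimum_vertex_cut G S" by (auto simp: minimum_vertex_cut_def)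
qed

section \<open>Edge count over the two sides of a minimum vertex-cut\<close>

theorem theorem5p3:
  fixes G :: "'a ugraph" and n m \<delta> \<kappa> :: nat
  assumes "simple_graph G" and "connected_graph G" and "triangle_free G"
    and "n = order G" and "m = size_graph G"
    and "\<delta> = min_degree G" and "\<delta> \<ge> 2"
    and "\<kappa> = vertex_connectivity G"
    and "int m \<ge> int \<delta> ^ 2 + \<lfloor>1 / 4 * (real n - real \<delta> - 1) ^ 2\<rfloor>"
  shows "\<kappa> = \<delta> \<or>
    (\<exists>X S Y. verts G = X \<union> S \<union> Y \<and> X \<inter> S = {} \<and> X \<inter> Y = {} \<and> S \<inter> Y = {} \<and>
       minimum_vertex_cut G S \<and>
       graph_iso (induced G S) (edgeless_graph (\<delta> - 1)) \<and>
       graph_iso (induced G (X \<union> S)) (complete_bipartite \<delta> \<delta>) \<and>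
       graph_iso (induced G (Y \<union> S))
         (complete_bipartite (nat \<lceil>(real n - real \<delta> - 1) / 2\<rceil>)
                             (nat \<lfloor>(real n - real \<delta> - 1) / 2\<rfloor>)))"
proof (cases "\<kappa> = \<delta>")
  case False
  note G = assms(1,3)
  have fV: "finite (verts G)" using assms(1) by (simp add: simple_graph_def)
  have fE: "finite (edges G)"
    by (rule finite_subset[of _ "Pow (verts G)"]) (use assms(1) in \<open>auto simp: simple_graph_def\<close>)
  have k: "\<kappa> < \<delta>"
    using False vertex_connectivity_le_min_degree[OF assms(1-3)] assms(6-8) by auto
  obtain S where Smin: "minimum_vertex_cut G S"
    using ex_minimum_vertex_cut[OF assms(1-3)] assms(6,7) by auto
  then have S: "vertex_cut G S" "card S = \<kappa>" by (auto simp: minimum_vertex_cut_def assms(8))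
  then obtain X Y where V: "verts G = X \<union> S \<union> Y" "X \<inter> S = {}" "X \<inter> Y = {}" "S \<inter> Y = {}"
    and ne: "X \<noteq> {}" "Y \<noteq> {}" and XY: "\<And>u v. u \<in> X \<Longrightarrow> v \<in> Y \<Longrightarrow> (u, v) \<notin> adj G"
    using vertex_cut_partition[OF assms(1)] by metis
  have fin: "finite X" "finite S" "finite Y" using fV V by auto
  have a: "2 * \<delta> \<le> card (X \<union> S)"
  proof -
    obtain x where "x \<in> X" using ne by auto
    moreover have "v \<in> X \<union> S" if "u \<in> X" "(u, v) \<in> adj G" for u v
      using that XY V adj_verts(2)[OF assms(1) that(2)] by blast
    ultimately show ?thesis
      using two_min_degree_le_card[OF G, of "X \<union> S" X x S] V fin k S assms(6) by blast
  qed
  have b: "2 * \<delta> \<le> card (Y \<union> S)"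
  proof -
    obtain y where "y \<in> Y" using ne by auto
    moreover have "v \<in> Y \<union> S" if "u \<in> Y" "(u, v) \<in> adj G" for u v
      using that XY V adj_verts(2)[OF assms(1) that(2)] adj_sym[OF that(2)] by blast
    ultimately show ?thesis
      using two_min_degree_le_card[OF G, of "Y \<union> S" Y y S] V fin k S assms(6) by blast
  qed
  \<comment> \<open>\<open>N\<close> will be the order of the part opposite to the one with
    \<open>2 * \<delta>\<close> vertices. The truncated subtraction is harmless, since
    \<open>a\<close> and the nonempty \<open>Y\<close> give \<open>n > 2 * \<delta>\<close>.\<close>
  define N where "N = n - \<delta> - 1"
  have ca: "card (X \<union> S) = card X + \<kappa>" and cb: "card (Y \<union> S) = card Y + \<kappa>"
    using fin V S by (auto simp: card_Un_disjoint Int_commute)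
  have "n = card (X \<union> S) + card Y"
    unfolding assms(4) order_def V(1) using fin V by (intro card_Un_disjoint) auto
  then have n: "n = card X + \<kappa> + card Y" using ca by simp
  then have N: "n = N + \<delta> + 1" using a b ca cb k assms(7) by (auto simp: N_def)
  have rN: "real n - real \<delta> - 1 = real N" using N by simp
  have "\<lfloor>1 / 4 * (real N) ^ 2\<rfloor> = int (N ^ 2 div 4)"
    using floor_divide_of_nat_eq[of "N ^ 2" 4, where 'a = real] by simp
  then have m: "\<delta> ^ 2 + N ^ 2 div 4 \<le> m"
    using assms(9) unfolding rN by (metis of_nat_add of_nat_le_iff of_nat_power)
  let ?E = "\<lambda>Z. {e \<in> edges G. e \<subseteq> Z}"
  have cover: "edges G = ?E (X \<union> S) \<union> ?E (Y \<union> S)"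
  proof -
    have "e \<subseteq> X \<union> S \<or> e \<subseteq> Y \<union> S" if e: "e \<in> edges G" for e
    proof -
      obtain u v where "e = {u, v}" using e assms(1) by (metis simple_graph_def card_2_iff)
      then have "(u, v) \<in> adj G" using e by (simp add: adj_def)
      then show ?thesis
        using XY[of u v] XY[of v u] adj_sym[of u v G] adj_verts[OF assms(1), of u v] V(1)
          \<open>e = {u, v}\<close> by blast
    qed
    then show ?thesis by blast
  qed
  have SE: "?E (X \<union> S) \<inter> ?E (Y \<union> S) = ?E S" using V by blast
  \<comment> \<open>Inclusion-exclusion: exactly the edges inside \<open>S\<close> are counted on
    both sides.\<close>
  have count: "m + card (?E S) = card (?E (X \<union> S)) + card (?E (Y \<union> S))"
    unfolding assms(5) size_graph_def SE[symmetric]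
    using card_Un_Int[of "?E (X \<union> S)" "?E (Y \<union> S)"] fE cover by simp
  have XS: "X \<union> S \<subseteq> verts G" "X \<union> S \<noteq> {}" and YS: "Y \<union> S \<subseteq> verts G" "Y \<union> S \<noteq> {}"
    using V ne by auto
  note la = card_edges_induced_le[OF G XS] and lb = card_edges_induced_le[OF G YS]
  \<comment> \<open>The left-hand side is \<open>n + \<kappa>\<close>, and
    \<open>\<kappa> \<le> \<delta> - 1\<close>. Equality here will therefore give
    \<open>\<kappa> = \<delta> - 1\<close>.\<close>
  have "card (X \<union> S) + card (Y \<union> S) \<le> N + 2 * \<delta>"
    using ca cb n N k by linarith
  moreover have "\<delta> ^ 2 + N ^ 2 div 4 \<le> card (X \<union> S) ^ 2 div 4 + card (Y \<union> S) ^ 2 div 4"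
    using m count la lb by linarith
  ultimately have ab: "card (X \<union> S) + card (Y \<union> S) = N + 2 * \<delta>"
    and or: "card (X \<union> S) = 2 * \<delta> \<or> card (Y \<union> S) = 2 * \<delta>"
    using sum_square_div_4_extremal[OF _ a b] assms(7) by auto
  have k1: "\<kappa> = \<delta> - 1" using ab ca cb n N by linarith
  \<comment> \<open>One part has \<open>2 * \<delta>\<close> vertices and the other
    \<open>N\<close>, so the upper bound from Mantel meets the lower bound on \<open>m\<close>. Both
    parts are then extremal and \<open>S\<close> spans no edge.\<close>
  have "card (X \<union> S) ^ 2 div 4 + card (Y \<union> S) ^ 2 div 4 = \<delta> ^ 2 + N ^ 2 div 4"
    using or ab by (auto simp: power_mult_distrib)
  with m count la lb have ea: "card (?E (X \<union> S)) = card (X \<union> S) ^ 2 div 4"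
    and eb: "card (?E (Y \<union> S)) = card (Y \<union> S) ^ 2 div 4" and "card (?E S) = 0"
    by linarith+
  then have eS: "?E S = {}" using fE by simp
  have isoS: "graph_iso (induced G S) (edgeless_graph (\<delta> - 1))"
  proof (rule graph_iso_edgeless_graph)
    show "card (verts (induced G S)) = \<delta> - 1"
      using S k1 by (simp add: induced_def vertex_cut_def Int_absorb1)
  qed (use eS fin in \<open>auto simp: induced_def\<close>)
  note iso = iso_induced_extremal[OF G XS ea] iso_induced_extremal[OF G YS eb]
  have "\<lceil>real N / 2\<rceil> = int ((N + 1) div 2)" by linarith
  then have up: "nat \<lceil>(real n - real \<delta> - 1) / 2\<rceil> = (N + 1) div 2" unfolding rN by simp
  have "\<lfloor>real N / 2\<rfloor> = int (N div 2)" by linarith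
  then have dn: "nat \<lfloor>(real n - real \<delta> - 1) / 2\<rfloor> = N div 2" unfolding rN by simp
  from or show ?thesis
  proof
    assume "card (X \<union> S) = 2 * \<delta>"
    then have "graph_iso (induced G (X \<union> S)) (complete_bipartite \<delta> \<delta>)"
      "graph_iso (induced G (Y \<union> S)) (complete_bipartite ((N + 1) div 2) (N div 2))"
      using iso ab by auto
    then show ?thesis unfolding up dn using V Smin isoS by blast
  next
    \<comment> \<open>The first set in the conclusion belongs to the part with
      \<open>2 * \<delta>\<close> vertices, so \<open>X\<close> and \<open>Y\<close> swap
      roles.\<close>
    assume "card (Y \<union> S) = 2 * \<delta>"
    then have "graph_iso (induced G (Y \<union> S)) (complete_bipartite \<delta> \<delta>)"
      "graph_iso (induced G (X \<union> S)) (complete_bipartite ((N + 1) div 2) (N div 2))"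
      using iso ab by auto
    moreover have "verts G = Y \<union> S \<union> X" "Y \<inter> S = {}" "Y \<inter> X = {}" "S \<inter> X = {}"
      using V by auto
    ultimately show ?thesis unfolding up dn using Smin isoS by blast
  qed
qed simp

end
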